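(* Operational equivalence $\simeq$ is a Hilbert–Post complete equational theory for the extended stack calculus: it is a consistent theory (a congruence containing $=_s$), and every such theory that properly contains it is inconsistent.
   Context: The extended stack calculus. Fix a countably infinite set of stack variables $\alpha,\beta,\gamma,\ldots$. Expressions: stacks $\pi ::= \mathsf{nil}\mid\alpha\mid\mathsf{cdr}(\pi)\mid M::\pi$; terms $M ::= \mathsf{car}(\pi)\mid\mu\alpha.M\mid M\star\pi$. Application $\star$ associates to the left and has precedence over $\mu$; $::$ is right-associative and binds tighter than $\star$. We write $\mu\vec\alpha.M\star\vec\pi$ for $\mu\alpha_1\ldots\mu\alpha_n.(M\star\pi_1\star\cdots\star\pi_m)$. $\mu\alpha$ binds $\alpha$; $E\{\pi/\alpha\}$ is capture-avoiding substitution; $\mathrm{FV}(E)$ are the free variables. Reduction rules: $(\mu\alpha.M)\star\pi\to M\{\pi/\alpha\}$, $\mathsf{car}(M::\pi)\to M$, $\mathsf{cdr}(M::\pi)\to\pi$; $=_s$ is the equivalence closure of their contextual closure. $\mathsf{cdr}^n(\pi)$ is $n$-fold $\mathsf{cdr}$, $\mathsf{car}_n(\pi):=\mathsf{car}(\mathsf{cdr}^n(\pi))$. The canonical form of an expression is its normal form w.r.t. the $\mathsf{car},\mathsf{cdr}$ rules alone. Head reduction (deterministic, no contextual closure): $M\to_h\mu\vec\alpha.N\{\varpi/\beta\}\star\vec\pi$ if $\mu\vec\alpha.(\mu\beta.N)\star\varpi\star\vec\pi$ is the canonical form of $M$. A head normal form (hnf) is a non-$\to_h$-reducible term, i.e.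 one of shape $\mu\vec\alpha.H\star\vec\pi$ with $H=\mathsf{car}_n(\beta)$ (proper hnf) or $H=\mathsf{car}_n(\mathsf{nil})$ (improper hnf). A term has a proper hnf if it $\to_h$-reduces in finitely many steps to a proper hnf. Head contexts: $C[\cdot]::=[\cdot]\mid C[\cdot]\star\pi\mid\mu\alpha.C[\cdot]$. $M\simeq N$ iff for every head context $C[\cdot]$, $C[M]$ has a proper hnf iff $C[N]$ has a proper hnf. A theory is a set $\mathcal T$ of equalities between expressions containing $=_s$ and closed under context formation and replacement of $\mathcal T$-equal subexpressions; it is inconsistent if $\mu\gamma.M\star\gamma=_{\mathcal T}\mu\gamma.N\star\gamma$ for all terms $M,N$ and every $\gamma\notin\mathrm{FV}(M)\cup\mathrm{FV}(N)$, consistent otherwise. Hilbert–Post complete means maximally consistent. *)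

theory Defs
  imports Main
begin

section \<open>Syntax\<close>

text \<open>
  Expressions modulo alpha-equivalence, in de Bruijn notation: \<open>Svar i\<close> refers to the \<open>i\<close>-th
  enclosing \<open>Mu\<close>, and indices pointing beyond all enclosing binders are the free stack variables.
\<close>

datatype stack = Snil | Svar nat | Scdr stack | Scons trm stack
and trm = Car stack | Mu trm | App trm stack

primrec lift_stack :: "nat \<Rightarrow> stack \<Rightarrow> stack" and lift_trm :: "nat \<Rightarrow> trm \<Rightarrow> trm" where
  "lift_stack k Snil = Snil"
| "lift_stack k (Svar i) = (if i < k then Svar i else Svar (Suc i))"
| "lift_stack k (Scdr p) = Scdr (lift_stack k p)"
| "lift_stack k (Scons M p) = Scons (lift_trm k M) (lift_stack k p)"
| "lift_trm k (Car p) = Car (lift_stack k p)"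
| "lift_trm k (Mu M) = Mu (lift_trm (Suc k) M)"
| "lift_trm k (App M p) = App (lift_trm k M) (lift_stack k p)"

text \<open>
  \<open>subst_trm k q M\<close> replaces the index \<open>k\<close> by \<open>q\<close> and lowers the indices above \<open>k\<close>, as needed when
  the binder of \<open>k\<close> disappears in a contraction.
\<close>

primrec subst_stack :: "nat \<Rightarrow> stack \<Rightarrow> stack \<Rightarrow> stack"
  and subst_trm :: "nat \<Rightarrow> stack \<Rightarrow> trm \<Rightarrow> trm" where
  "subst_stack k q Snil = Snil"
| "subst_stack k q (Svar i) = (if i < k then Svar i else if i = k then q else Svar (i - 1))"
| "subst_stack k q (Scdr p) = Scdr (subst_stack k q p)"
| "subst_stack k q (Scons M p) = Scons (subst_trm k q M) (subst_stack k q p)"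
| "subst_trm k q (Car p) = Car (subst_stack k q p)"
| "subst_trm k q (Mu M) = Mu (subst_trm (Suc k) (lift_stack 0 q) M)"
| "subst_trm k q (App M p) = App (subst_trm k q M) (subst_stack k q p)"

definition mus :: "nat \<Rightarrow> trm \<Rightarrow> trm" where
  "mus n M = (Mu ^^ n) M"

definition apps :: "trm \<Rightarrow> stack list \<Rightarrow> trm" where
  "apps M ps = foldl App M ps"

definition car_n :: "nat \<Rightarrow> stack \<Rightarrow> trm" where
  "car_n n p = Car ((Scdr ^^ n) p)"


section \<open>Reduction\<close>

inductive ctx_trm :: "(trm \<Rightarrow> trm \<Rightarrow> bool) \<Rightarrow> (stack \<Rightarrow> stack \<Rightarrow> bool) \<Rightarrow> trm \<Rightarrow> trm \<Rightarrow> bool"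
  and ctx_stack :: "(trm \<Rightarrow> trm \<Rightarrow> bool) \<Rightarrow> (stack \<Rightarrow> stack \<Rightarrow> bool) \<Rightarrow> stack \<Rightarrow> stack \<Rightarrow> bool"
  for R S where
  root_trm: "R M N \<Longrightarrow> ctx_trm R S M N"
| ctx_Car: "ctx_stack R S p q \<Longrightarrow> ctx_trm R S (Car p) (Car q)"
| ctx_Mu: "ctx_trm R S M N \<Longrightarrow> ctx_trm R S (Mu M) (Mu N)"
| ctx_App1: "ctx_trm R S M N \<Longrightarrow> ctx_trm R S (App M p) (App N p)"
| ctx_App2: "ctx_stack R S p q \<Longrightarrow> ctx_trm R S (App M p) (App M q)"
| root_stack: "S p q \<Longrightarrow> ctx_stack R S p q"
| ctx_Scdr: "ctx_stack R S p q \<Longrightarrow> ctx_stack R S (Scdr p) (Scdr q)"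
| ctx_Scons1: "ctx_trm R S M N \<Longrightarrow> ctx_stack R S (Scons M p) (Scons N p)"
| ctx_Scons2: "ctx_stack R S p q \<Longrightarrow> ctx_stack R S (Scons M p) (Scons M q)"

inductive car_rule :: "trm \<Rightarrow> trm \<Rightarrow> bool" where
  "car_rule (Car (Scons M p)) M"

inductive cdr_rule :: "stack \<Rightarrow> stack \<Rightarrow> bool" where
  "cdr_rule (Scdr (Scons M p)) p"

inductive mu_rule :: "trm \<Rightarrow> trm \<Rightarrow> bool" where
  "mu_rule (App (Mu M) p) (subst_trm 0 p M)"

abbreviation red_trm :: "trm \<Rightarrow> trm \<Rightarrow> bool" where
  "red_trm \<equiv> ctx_trm (sup mu_rule car_rule) cdr_rule"

abbreviation red_stack :: "stack \<Rightarrow> stack \<Rightarrow> bool" where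
  "red_stack \<equiv> ctx_stack (sup mu_rule car_rule) cdr_rule"

abbreviation red_cc :: "trm \<Rightarrow> trm \<Rightarrow> bool" where
  "red_cc \<equiv> ctx_trm car_rule cdr_rule"

definition canonical_form :: "trm \<Rightarrow> trm \<Rightarrow> bool" where
  "canonical_form M N \<longleftrightarrow> red_cc\<^sup>*\<^sup>* M N \<and> (\<nexists>P. red_cc N P)"

inductive head_red :: "trm \<Rightarrow> trm \<Rightarrow> bool" where
  "canonical_form M (mus n (apps (App (Mu N) q) ps)) \<Longrightarrow>
   head_red M (mus n (apps (subst_trm 0 q N) ps))"

text \<open>
  Head reduction inspects a term only through its canonical form, and so do head normal forms:
  \<open>Car (Scons (Car (Svar i)) p)\<close> is not head reducible and counts as a proper one.
\<close>

definition proper_hnf :: "trm \<Rightarrow> bool" where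
  "proper_hnf M \<longleftrightarrow> (\<exists>m n i ps. canonical_form M (mus m (apps (car_n n (Svar i)) ps)))"

definition has_proper_hnf :: "trm \<Rightarrow> bool" where
  "has_proper_hnf M \<longleftrightarrow> (\<exists>N. head_red\<^sup>*\<^sup>* M N \<and> proper_hnf N)"


section \<open>Operational equivalence\<close>

datatype head_context = Hole | HApp head_context stack | HMu head_context

text \<open>Filling the hole does not lift indices: head contexts may capture variables.\<close>

primrec fill :: "head_context \<Rightarrow> trm \<Rightarrow> trm" where
  "fill Hole M = M"
| "fill (HApp C p) M = App (fill C M) p"
| "fill (HMu C) M = Mu (fill C M)"

definition op_equiv :: "trm \<Rightarrow> trm \<Rightarrow> bool" where
  "op_equiv M N \<longleftrightarrow> (\<forall>C. has_proper_hnf (fill C M) \<longleftrightarrow> has_proper_hnf (fill C N))"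

text \<open>
  Theories also relate stacks. Stacks are observed by applying terms to them, that is, through the
  contexts \<open>C[M \<star> [\<cdot>]]\<close> with \<open>C\<close> a head context. A theory whose equations between terms are those
  of \<^const>\<open>op_equiv\<close> cannot equate more stacks than this.
\<close>

definition op_equiv_stack :: "stack \<Rightarrow> stack \<Rightarrow> bool" where
  "op_equiv_stack p q \<longleftrightarrow> (\<forall>M. op_equiv (App M p) (App M q))"


section \<open>Theories\<close>

datatype equation = TEq trm trm | SEq stack stack

definition conversion :: "equation set" where
  "conversion = {TEq M N |M N. equivclp red_trm M N} \<union> {SEq p q |p q. equivclp red_stack p q}"

definition op_equivalence :: "equation set" where
  "op_equivalence = {TEq M N |M N. op_equiv M N} \<union> {SEq p q |p q. op_equiv_stack p q}"

text \<open>Reflexivity is part of the inclusion of \<^const>\<open>conversion\<close>.\<close>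

definition equational_theory :: "equation set \<Rightarrow> bool" where
  "equational_theory T \<longleftrightarrow>
     conversion \<subseteq> T \<and>
     (\<forall>M N. TEq M N \<in> T \<longrightarrow> TEq N M \<in> T) \<and>
     (\<forall>M N P. TEq M N \<in> T \<longrightarrow> TEq N P \<in> T \<longrightarrow> TEq M P \<in> T) \<and>
     (\<forall>p q. SEq p q \<in> T \<longrightarrow> SEq q p \<in> T) \<and>
     (\<forall>p q r. SEq p q \<in> T \<longrightarrow> SEq q r \<in> T \<longrightarrow> SEq p r \<in> T) \<and>
     (\<forall>p q. SEq p q \<in> T \<longrightarrow> TEq (Car p) (Car q) \<in> T) \<and>
     (\<forall>M N. TEq M N \<in> T \<longrightarrow> TEq (Mu M) (Mu N) \<in> T) \<and>
     (\<forall>M N p q. TEq M N \<in> T \<longrightarrow> SEq p q \<in> T \<longrightarrow> TEq (App M p) (App N q) \<in> T) \<and>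
     (\<forall>p q. SEq p q \<in> T \<longrightarrow> SEq (Scdr p) (Scdr q) \<in> T) \<and>
     (\<forall>M N p q. TEq M N \<in> T \<longrightarrow> SEq p q \<in> T \<longrightarrow> SEq (Scons M p) (Scons N q) \<in> T)"

text \<open>\<open>Mu (App (lift_trm 0 M) (Svar 0))\<close> is \<open>\<mu>\<gamma>. M \<star> \<gamma>\<close> with \<open>\<gamma>\<close> not free in \<open>M\<close>.\<close>

definition inconsistent :: "equation set \<Rightarrow> bool" where
  "inconsistent T \<longleftrightarrow>
     (\<forall>M N. TEq (Mu (App (lift_trm 0 M) (Svar 0))) (Mu (App (lift_trm 0 N) (Svar 0))) \<in> T)"

definition hilbert_post_complete :: "equation set \<Rightarrow> bool" where
  "hilbert_post_complete T \<longleftrightarrow>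
     equational_theory T \<and> \<not> inconsistent T \<and>
     (\<forall>T'. equational_theory T' \<longrightarrow> T \<subset> T' \<longrightarrow> inconsistent T')"

end

theory Submission imports Defs begin

text \<open>
  Head reduction to a proper head normal form is presented as a machine. It defines the preorder
  "converges under every substitution and against every list of stacks at least as often", and
  Howe's method shows this preorder to be compatible with all constructors. The reduction rules hold in the
  induced equivalence by inspection of the machine, so convergence is invariant under conversion and
  no separate standardisation theorem is needed. Head contexts can simulate substitutions, whence
  the induced equivalence is operational equivalence.

  For maximality, terms without proper head normal form stay so under substitution and application, hence they
  are all equivalent. If a theory equates such a term with one that has a proper head normal form,
  then a head context turns the latter into an arbitrary term \<open>P\<close>: substitute a stack
  \<open>X :: \<dots> :: X :: nil\<close> for the head variable, where \<open>X\<close> discards its arguments and returns \<open>P\<close>.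
  So every \<open>P\<close> is equated with a fixed term without proper head normal form.
\<close>

section \<open>Parallel substitution\<close>

definition up :: "(nat \<Rightarrow> stack) \<Rightarrow> nat \<Rightarrow> stack" where
  "up \<sigma> = case_nat (Svar 0) (\<lambda>i. lift_stack 0 (\<sigma> i))"

text \<open>Shifting and single substitution are both instances of parallel substitution, so their
  commutation laws reduce to laws for composing parallel substitutions.\<close>

primrec psub_stack :: "(nat \<Rightarrow> stack) \<Rightarrow> stack \<Rightarrow> stack"
  and psub_trm :: "(nat \<Rightarrow> stack) \<Rightarrow> trm \<Rightarrow> trm" where
  "psub_stack \<sigma> Snil = Snil"
| "psub_stack \<sigma> (Svar i) = \<sigma> i"
| "psub_stack \<sigma> (Scdr p) = Scdr (psub_stack \<sigma> p)"
| "psub_stack \<sigma> (Scons M p) = Scons (psub_trm \<sigma> M) (psub_stack \<sigma> p)"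
| "psub_trm \<sigma> (Car p) = Car (psub_stack \<sigma> p)"
| "psub_trm \<sigma> (Mu M) = Mu (psub_trm (up \<sigma>) M)"
| "psub_trm \<sigma> (App M p) = App (psub_trm \<sigma> M) (psub_stack \<sigma> p)"

lemma up_simps [simp]: "up \<sigma> 0 = Svar 0" "up \<sigma> (Suc i) = lift_stack 0 (\<sigma> i)"
  by (simp_all add: up_def)

lemma lift_eq_psub:
  "lift_stack k p = psub_stack (\<lambda>i. if i < k then Svar i else Svar (Suc i)) p"
  "lift_trm k M = psub_trm (\<lambda>i. if i < k then Svar i else Svar (Suc i)) M"
proof (induction p and M arbitrary: k and k rule: stack.induct trm.induct)
  case (Mu M)
  have "up (\<lambda>i. if i < k then Svar i else Svar (Suc i)) =
    (\<lambda>i. if i < Suc k then Svar i else Svar (Suc i))"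
    by (rule ext) (simp add: up_def split: nat.split)
  then show ?case using Mu by simp
qed simp_all

lemma lift0_eq_psub:
  "lift_stack 0 p = psub_stack (\<lambda>i. Svar (Suc i)) p" "lift_trm 0 M = psub_trm (\<lambda>i. Svar (Suc i)) M"
  by (simp_all add: lift_eq_psub)

lemma up_ren: "up (\<lambda>i. Svar (r i)) = (\<lambda>i. Svar (case i of 0 \<Rightarrow> 0 | Suc j \<Rightarrow> Suc (r j)))"
  by (rule ext) (simp add: up_def split: nat.split)

lemma psub_Svar [simp]: "psub_stack Svar p = p" "psub_trm Svar M = M"
proof (induction p and M rule: stack.induct trm.induct)
  case (Mu M)
  have "up Svar = Svar"
    by (rule ext) (simp add: up_def split: nat.split)
  then show ?case using Mu by simp
qed simp_all

text \<open>Composition is proved in stages, since its \<open>Mu\<close> case moves a substitution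
  past a shift: first substitution after renaming, then renaming after substitution
  (\<open>ren_psub\<close>), and from these the general law \<open>psub_psub\<close>.\<close>

lemma psub_ren:
  "psub_stack \<tau> (psub_stack (\<lambda>i. Svar (r i)) p) = psub_stack (\<lambda>i. \<tau> (r i)) p"
  "psub_trm \<tau> (psub_trm (\<lambda>i. Svar (r i)) M) = psub_trm (\<lambda>i. \<tau> (r i)) M"
proof (induction p and M arbitrary: \<tau> r and \<tau> r rule: stack.induct trm.induct)
  case (Mu M)
  have "(\<lambda>i. up \<tau> (case i of 0 \<Rightarrow> 0 | Suc j \<Rightarrow> Suc (r j))) = up (\<lambda>i. \<tau> (r i))"
    by (rule ext) (simp split: nat.split)
  then show ?case using Mu by (simp add: up_ren)
qed simp_all

lemma ren_psub:
  "psub_stack (\<lambda>i. Svar (r i)) (psub_stack \<sigma> p) = psub_stack (\<lambda>i. psub_stack (\<lambda>i. Svar (r i)) (\<sigma> i)) p"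
  "psub_trm (\<lambda>i. Svar (r i)) (psub_trm \<sigma> M) = psub_trm (\<lambda>i. psub_stack (\<lambda>i. Svar (r i)) (\<sigma> i)) M"
proof (induction p and M arbitrary: \<sigma> r and \<sigma> r rule: stack.induct trm.induct)
  case (Mu M)
  have "(\<lambda>i. psub_stack (up (\<lambda>i. Svar (r i))) (up \<sigma> i)) = up (\<lambda>i. psub_stack (\<lambda>i. Svar (r i)) (\<sigma> i))"
  proof
    fix i
    show "psub_stack (up (\<lambda>i. Svar (r i))) (up \<sigma> i) = up (\<lambda>i. psub_stack (\<lambda>i. Svar (r i)) (\<sigma> i)) i"
      by (cases i) (simp_all add: lift0_eq_psub psub_ren)
  qed
  then show ?case using Mu by (simp add: up_ren)
qed simp_all

lemma psub_up_lift: "psub_stack (up \<tau>) (lift_stack 0 p) = lift_stack 0 (psub_stack \<tau> p)"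
proof -
  have "psub_stack (up \<tau>) (lift_stack 0 p) = psub_stack (\<lambda>i. lift_stack 0 (\<tau> i)) p"
    by (simp only: lift0_eq_psub psub_ren) (simp add: lift0_eq_psub)
  also have "\<dots> = lift_stack 0 (psub_stack \<tau> p)"
    by (simp only: lift0_eq_psub ren_psub)
  finally show ?thesis .
qed

lemma psub_psub:
  "psub_stack \<tau> (psub_stack \<sigma> p) = psub_stack (\<lambda>i. psub_stack \<tau> (\<sigma> i)) p"
  "psub_trm \<tau> (psub_trm \<sigma> M) = psub_trm (\<lambda>i. psub_stack \<tau> (\<sigma> i)) M"
proof (induction p and M arbitrary: \<sigma> \<tau> and \<sigma> \<tau> rule: stack.induct trm.induct)
  case (Mu M)
  have "(\<lambda>i. psub_stack (up \<tau>) (up \<sigma> i)) = up (\<lambda>i. psub_stack \<tau> (\<sigma> i))"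
  proof
    fix i
    show "psub_stack (up \<tau>) (up \<sigma> i) = up (\<lambda>i. psub_stack \<tau> (\<sigma> i)) i"
      by (cases i) (simp_all add: psub_up_lift)
  qed
  then show ?case using Mu by simp
qed simp_all

lemma subst_eq_psub:
  "subst_stack k q p = psub_stack (\<lambda>i. if i < k then Svar i else if i = k then q else Svar (i - 1)) p"
  "subst_trm k q M = psub_trm (\<lambda>i. if i < k then Svar i else if i = k then q else Svar (i - 1)) M"
proof (induction p and M arbitrary: k q and k q rule: stack.induct trm.induct)
  case (Mu M)
  have "up (\<lambda>i. if i < k then Svar i else if i = k then q else Svar (i - 1)) =
    (\<lambda>i. if i < Suc k then Svar i else if i = Suc k then lift_stack 0 q else Svar (i - 1))"
    by (rule ext) (auto simp add: up_def split: nat.split)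
  then show ?case using Mu by simp
qed simp_all

lemma subst0_eq_psub: "subst_trm 0 q M = psub_trm (case_nat q Svar) M"
proof -
  have "(\<lambda>i. if i < 0 then Svar i else if i = 0 then q else Svar (i - 1)) = case_nat q Svar"
    by (rule ext) (simp split: nat.split)
  then show ?thesis by (simp only: subst_eq_psub)
qed

lemma psub_case_nat_lift: "psub_stack (case_nat q \<sigma>) (lift_stack 0 p) = psub_stack \<sigma> p"
  by (simp add: lift0_eq_psub psub_ren)

lemma psub_subst0: "psub_trm \<sigma> (subst_trm 0 q M) = psub_trm (case_nat (psub_stack \<sigma> q) \<sigma>) M"
proof -
  have "(\<lambda>i. psub_stack \<sigma> (case_nat q Svar i)) = case_nat (psub_stack \<sigma> q) \<sigma>"
    by (rule ext) (simp split: nat.split)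
  then show ?thesis by (simp add: subst0_eq_psub psub_psub)
qed

text \<open>Together with \<open>psub_subst0\<close> this makes contraction commute with
  substitution: either order of the two amounts to the same parallel substitution.\<close>

lemma subst0_psub_up: "subst_trm 0 q (psub_trm (up \<sigma>) M) = psub_trm (case_nat q \<sigma>) M"
proof -
  have "(\<lambda>i. psub_stack (case_nat q Svar) (up \<sigma> i)) = case_nat q \<sigma>"
    by (rule ext) (simp add: psub_case_nat_lift split: nat.split)
  then show ?thesis by (simp add: subst0_eq_psub psub_psub)
qed

text \<open>A strict upper bound on the free indices. Truncated subtraction keeps it at 0 under
  \<open>Mu\<close> when the body has no free index.\<close>

primrec bound_stack :: "stack \<Rightarrow> nat" and bound_trm :: "trm \<Rightarrow> nat" where
  "bound_stack Snil = 0"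
| "bound_stack (Svar i) = Suc i"
| "bound_stack (Scdr p) = bound_stack p"
| "bound_stack (Scons M p) = max (bound_trm M) (bound_stack p)"
| "bound_trm (Car p) = bound_stack p"
| "bound_trm (Mu M) = bound_trm M - 1"
| "bound_trm (App M p) = max (bound_trm M) (bound_stack p)"

lemma psub_cong_bound:
  "(\<And>i. i < bound_stack p \<Longrightarrow> \<sigma> i = \<tau> i) \<Longrightarrow> psub_stack \<sigma> p = psub_stack \<tau> p"
  "(\<And>i. i < bound_trm M \<Longrightarrow> \<sigma> i = \<tau> i) \<Longrightarrow> psub_trm \<sigma> M = psub_trm \<tau> M"
proof (induction p and M arbitrary: \<sigma> \<tau> and \<sigma> \<tau> rule: stack.induct trm.induct)
  case (Scons M p)
  show ?case using Scons.IH(1)[of \<sigma> \<tau>] Scons.IH(2)[of \<sigma> \<tau>] by (simp add: Scons.prems)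
next
  case (Mu M)
  have "up \<sigma> i = up \<tau> i" if "i < bound_trm M" for i
    using that Mu.prems by (cases i) simp_all
  then have "psub_trm (up \<sigma>) M = psub_trm (up \<tau>) M"
    by (rule Mu.IH)
  then show ?case by simp
next
  case (App M p)
  show ?case using App.IH(1)[of \<sigma> \<tau>] App.IH(2)[of \<sigma> \<tau>] by (simp add: App.prems)
next
  case (Scdr p)
  show ?case using Scdr.IH[of \<sigma> \<tau>] by (simp add: Scdr.prems)
next
  case (Car p)
  show ?case using Car.IH[of \<sigma> \<tau>] by (simp add: Car.prems)
qed simp_all

lemma apps_simps [simp]: "apps M [] = M" "apps M (p # ps) = apps (App M p) ps"
  by (simp_all add: apps_def)

lemma apps_append: "apps M (ps @ qs) = apps (apps M ps) qs"
  by (simp add: apps_def)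

lemma mus_simps [simp]: "mus 0 M = M" "mus (Suc n) M = Mu (mus n M)"
  by (simp_all add: mus_def)


section \<open>Convergence\<close>

text \<open>
  Head reduction to a proper head normal form as an abstract machine: \<open>conv_trm M ps\<close> stands for
  \<open>apps M ps\<close> and \<open>conv_stack p n ps\<close> for \<open>apps (car_n n p) ps\<close>.
\<close>

inductive conv_trm :: "trm \<Rightarrow> stack list \<Rightarrow> bool"
  and conv_stack :: "stack \<Rightarrow> nat \<Rightarrow> stack list \<Rightarrow> bool" where
  conv_App: "conv_trm M (p # ps) \<Longrightarrow> conv_trm (App M p) ps"
| conv_beta: "conv_trm (subst_trm 0 p M) ps \<Longrightarrow> conv_trm (Mu M) (p # ps)"
| conv_Mu: "conv_trm M [] \<Longrightarrow> conv_trm (Mu M) []"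
| conv_Car: "conv_stack p 0 ps \<Longrightarrow> conv_trm (Car p) ps"
| conv_Scdr: "conv_stack p (Suc n) ps \<Longrightarrow> conv_stack (Scdr p) n ps"
| conv_Scons_0: "conv_trm M ps \<Longrightarrow> conv_stack (Scons M p) 0 ps"
| conv_Scons_Suc: "conv_stack p n ps \<Longrightarrow> conv_stack (Scons M p) (Suc n) ps"
| conv_Svar: "conv_stack (Svar i) n ps"

text \<open>At most one rule fits each configuration, so every rule can be inverted. No rule starts
  from \<open>Snil\<close>, which is how improper head normal forms fail to converge.\<close>

lemma conv_simps [simp]:
  "conv_trm (App M p) ps \<longleftrightarrow> conv_trm M (p # ps)"
  "conv_trm (Mu M) (p # ps) \<longleftrightarrow> conv_trm (subst_trm 0 p M) ps"
  "conv_trm (Mu M) [] \<longleftrightarrow> conv_trm M []"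
  "conv_trm (Car p) ps \<longleftrightarrow> conv_stack p 0 ps"
  "conv_stack (Scdr p) n ps \<longleftrightarrow> conv_stack p (Suc n) ps"
  "conv_stack (Scons M p) 0 ps \<longleftrightarrow> conv_trm M ps"
  "conv_stack (Scons M p) (Suc n) ps \<longleftrightarrow> conv_stack p n ps"
  "conv_stack (Svar i) n ps"
  "\<not> conv_stack Snil n ps"
  by (auto intro: conv_trm_conv_stack.intros elim: conv_trm.cases conv_stack.cases)

lemma conv_apps [simp]: "conv_trm (apps M ps) qs \<longleftrightarrow> conv_trm M (ps @ qs)"
  by (induction ps arbitrary: M) simp_all

lemma conv_Scdr_funpow [simp]: "conv_stack ((Scdr ^^ m) p) n ps \<longleftrightarrow> conv_stack p (n + m) ps"
  by (induction m arbitrary: n) simp_all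

lemma conv_mus_Nil: "conv_trm (mus n M) [] \<longleftrightarrow> conv_trm M []"
  by (induction n) simp_all

text \<open>The uninstantiated configuration imitates the run of its instance, possibly stopping
  early at a variable. Read contrapositively, divergence survives substitution and the further
  arguments \<open>qs\<close>.\<close>

lemma conv_psub_imp_conv:
  "conv_trm P rs \<Longrightarrow> P = psub_trm \<sigma> M \<Longrightarrow> rs = map (psub_stack \<sigma>) ps @ qs \<Longrightarrow> conv_trm M ps"
  "conv_stack s n rs \<Longrightarrow> s = psub_stack \<sigma> p \<Longrightarrow> rs = map (psub_stack \<sigma>) ps @ qs \<Longrightarrow> conv_stack p n ps"
proof (induction arbitrary: \<sigma> M ps qs and \<sigma> p ps qs rule: conv_trm_conv_stack.inducts)
  case (conv_App M' p' rs)
  from conv_App.prems obtain N q where M: "M = App N q" "M' = psub_trm \<sigma> N" "p' = psub_stack \<sigma> q"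
    by (cases M) auto
  show ?case
    using conv_App.IH[of \<sigma> N "q # ps" qs] conv_App.prems M by simp
next
  case (conv_beta p' M' rs)
  from conv_beta.prems obtain N where M: "M = Mu N" "M' = psub_trm (up \<sigma>) N"
    by (cases M) auto
  show ?case
  proof (cases ps)
    \<comment> \<open>The binder meets an argument from the suffix \<open>qs\<close>. That argument
      moves into the substitution, while the uninstantiated term merely enters its body.\<close>
    case Nil
    then have "conv_trm N []"
      using conv_beta.prems M by (intro conv_beta.IH[of "case_nat p' \<sigma>" N "[]" rs]) (simp_all add: subst0_psub_up)
    then show ?thesis using Nil M by simp
  next
    case (Cons q ps')
    then have "conv_trm (subst_trm 0 q N) ps'"
      using conv_beta.prems M
      by (intro conv_beta.IH[of \<sigma> _ _ qs]) (simp_all add: subst0_psub_up psub_subst0)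
    then show ?thesis using Cons M by simp
  qed
next
  case (conv_Mu M')
  then show ?case by (cases M) auto
next
  case (conv_Car p' rs)
  then show ?case by (cases M) auto
next
  case (conv_Scdr p' n rs)
  then show ?case by (cases p) auto
next
  case (conv_Scons_0 M' rs p')
  then show ?case by (cases p) auto
next
  case (conv_Scons_Suc p' n rs M')
  then show ?case by (cases p) auto
next
  case (conv_Svar i n rs)
  then show ?case by (cases p) auto
qed


section \<open>Closed-instance preorder\<close>

definition le_trm :: "trm \<Rightarrow> trm \<Rightarrow> bool" where
  "le_trm M N \<longleftrightarrow> (\<forall>\<sigma> ps. conv_trm (psub_trm \<sigma> M) ps \<longrightarrow> conv_trm (psub_trm \<sigma> N) ps)"

text \<open>A stack is tested through each of its components: \<open>conv_stack p n ps\<close> runs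
  component \<open>n\<close> of \<open>p\<close> on the arguments \<open>ps\<close>.\<close>

definition le_stack :: "stack \<Rightarrow> stack \<Rightarrow> bool" where
  "le_stack p q \<longleftrightarrow> (\<forall>\<sigma> n ps. conv_stack (psub_stack \<sigma> p) n ps \<longrightarrow> conv_stack (psub_stack \<sigma> q) n ps)"

lemma le_refl [simp]: "le_trm M M" "le_stack p p"
  by (simp_all add: le_trm_def le_stack_def)

lemma le_trans:
  "le_trm M N \<Longrightarrow> le_trm N P \<Longrightarrow> le_trm M P"
  "le_stack p q \<Longrightarrow> le_stack q r \<Longrightarrow> le_stack p r"
  by (simp_all add: le_trm_def le_stack_def)

lemma le_psub:
  "le_trm M N \<Longrightarrow> le_trm (psub_trm \<sigma> M) (psub_trm \<sigma> N)"
  "le_stack p q \<Longrightarrow> le_stack (psub_stack \<sigma> p) (psub_stack \<sigma> q)"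
  by (simp_all add: le_trm_def le_stack_def psub_psub)

lemma le_conv:
  "le_trm M N \<Longrightarrow> conv_trm M ps \<Longrightarrow> conv_trm N ps"
  "le_stack p q \<Longrightarrow> conv_stack p n ps \<Longrightarrow> conv_stack q n ps"
  unfolding le_trm_def le_stack_def by (metis psub_Svar)+

text \<open>Howe's closure: compatible by construction and closed under composition with \<open>le\<close> on the right.\<close>

inductive howe_trm :: "trm \<Rightarrow> trm \<Rightarrow> bool" and howe_stack :: "stack \<Rightarrow> stack \<Rightarrow> bool" where
  howe_Car: "howe_stack p p' \<Longrightarrow> le_trm (Car p') Q \<Longrightarrow> howe_trm (Car p) Q"
| howe_Mu: "howe_trm M M' \<Longrightarrow> le_trm (Mu M') Q \<Longrightarrow> howe_trm (Mu M) Q"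
| howe_App: "howe_trm M M' \<Longrightarrow> howe_stack p p' \<Longrightarrow> le_trm (App M' p') Q \<Longrightarrow> howe_trm (App M p) Q"
| howe_Snil: "le_stack Snil q \<Longrightarrow> howe_stack Snil q"
| howe_Svar: "le_stack (Svar i) q \<Longrightarrow> howe_stack (Svar i) q"
| howe_Scdr: "howe_stack p p' \<Longrightarrow> le_stack (Scdr p') q \<Longrightarrow> howe_stack (Scdr p) q"
| howe_Scons: "howe_trm M M' \<Longrightarrow> howe_stack p p' \<Longrightarrow> le_stack (Scons M' p') q \<Longrightarrow>
    howe_stack (Scons M p) q"

inductive_cases howe_CarE: "howe_trm (Car p) Q"
inductive_cases howe_MuE: "howe_trm (Mu M) Q"
inductive_cases howe_AppE: "howe_trm (App M p) Q"
inductive_cases howe_SvarE: "howe_stack (Svar i) q"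
inductive_cases howe_ScdrE: "howe_stack (Scdr p) q"
inductive_cases howe_SconsE: "howe_stack (Scons M p) q"

section \<open>Substitutivity of Howe's closure and its agreement with the preorder\<close>

lemma howe_refl [simp]: "howe_stack p p" "howe_trm M M"
  by (induction p and M rule: stack.induct trm.induct)
    (auto intro: howe_trm_howe_stack.intros)

lemma howe_le:
  "howe_trm M N \<Longrightarrow> le_trm N P \<Longrightarrow> howe_trm M P"
  "howe_stack p q \<Longrightarrow> le_stack q r \<Longrightarrow> howe_stack p r"
  by (erule howe_trm.cases howe_stack.cases; blast intro: howe_trm_howe_stack.intros le_trans)+

text \<open>The special case of \<open>howe_psub\<close> for shifting, required there to carry
  related substitutions under a binder.\<close>

lemma howe_ren:
  "howe_trm M N \<Longrightarrow> howe_trm (psub_trm (\<lambda>i. Svar (r i)) M) (psub_trm (\<lambda>i. Svar (r i)) N)"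
  "howe_stack p q \<Longrightarrow> howe_stack (psub_stack (\<lambda>i. Svar (r i)) p) (psub_stack (\<lambda>i. Svar (r i)) q)"
proof (induction arbitrary: r and r rule: howe_trm_howe_stack.inducts)
  case (howe_Car p p' Q)
  show ?case using howe_Car.IH[of r] le_psub(1)[OF howe_Car.hyps(2), of "\<lambda>i. Svar (r i)"]
    by (auto intro: howe_trm_howe_stack.intros)
next
  case (howe_Mu M M' Q)
  show ?case
    using howe_Mu.IH le_psub(1)[OF howe_Mu.hyps(2), of "\<lambda>i. Svar (r i)"]
    by (auto simp: up_ren intro: howe_trm_howe_stack.intros)
next
  case (howe_App M M' p p' Q)
  show ?case using howe_App.IH(1)[of r] howe_App.IH(2)[of r] le_psub(1)[OF howe_App.hyps(3), of "\<lambda>i. Svar (r i)"]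
    by (auto intro: howe_trm_howe_stack.intros)
next
  case (howe_Snil q)
  show ?case using le_psub(2)[OF howe_Snil.hyps(1), of "\<lambda>i. Svar (r i)"]
    by (auto intro: howe_trm_howe_stack.intros)
next
  case (howe_Svar i q)
  show ?case using le_psub(2)[OF howe_Svar.hyps(1), of "\<lambda>i. Svar (r i)"]
    by (auto intro: howe_trm_howe_stack.intros)
next
  case (howe_Scdr p p' q)
  show ?case using howe_Scdr.IH[of r] le_psub(2)[OF howe_Scdr.hyps(2), of "\<lambda>i. Svar (r i)"]
    by (auto intro: howe_trm_howe_stack.intros)
next
  case (howe_Scons M M' p p' q)
  show ?case using howe_Scons.IH(1)[of r] howe_Scons.IH(2)[of r] le_psub(2)[OF howe_Scons.hyps(3), of "\<lambda>i. Svar (r i)"]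
    by (auto intro: howe_trm_howe_stack.intros)
qed

lemma howe_up:
  assumes "\<And>i. howe_stack (\<sigma> i) (\<tau> i)"
  shows "howe_stack (up \<sigma> i) (up \<tau> i)"
  using assms howe_ren(2) by (cases i) (simp_all add: lift0_eq_psub)

text \<open>The \<open>Svar\<close> case relies on composition with \<open>le\<close> on the right:
  \<open>\<sigma> i\<close> is related to \<open>\<tau> i\<close>, which lies below the instance of
  the right-hand side.\<close>

lemma howe_psub:
  "howe_trm M N \<Longrightarrow> (\<And>i. howe_stack (\<sigma> i) (\<tau> i)) \<Longrightarrow> howe_trm (psub_trm \<sigma> M) (psub_trm \<tau> N)"
  "howe_stack p q \<Longrightarrow> (\<And>i. howe_stack (\<sigma> i) (\<tau> i)) \<Longrightarrow> howe_stack (psub_stack \<sigma> p) (psub_stack \<tau> q)"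
proof (induction arbitrary: \<sigma> \<tau> and \<sigma> \<tau> rule: howe_trm_howe_stack.inducts)
  case (howe_Car p p' Q)
  show ?case using howe_Car.IH[of \<sigma> \<tau>, OF howe_Car.prems] le_psub(1)[OF howe_Car.hyps(2), of \<tau>]
    by (auto intro: howe_trm_howe_stack.intros)
next
  case (howe_Mu M M' Q)
  show ?case
    using howe_Mu.IH[of "up \<sigma>" "up \<tau>", OF howe_up[OF howe_Mu.prems]] le_psub(1)[OF howe_Mu.hyps(2), of \<tau>]
    by (auto intro: howe_trm_howe_stack.intros)
next
  case (howe_App M M' p p' Q)
  show ?case using howe_App.IH(1)[of \<sigma> \<tau>, OF howe_App.prems] howe_App.IH(2)[of \<sigma> \<tau>, OF howe_App.prems]
      le_psub(1)[OF howe_App.hyps(3), of \<tau>]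
    by (auto intro: howe_trm_howe_stack.intros)
next
  case (howe_Snil q)
  show ?case using le_psub(2)[OF howe_Snil.hyps(1), of \<tau>]
    by (auto intro: howe_trm_howe_stack.intros)
next
  case (howe_Svar i q)
  show ?case using le_psub(2)[OF howe_Svar.hyps(1), of \<tau>] howe_Svar.prems[of i] howe_le(2)
    by auto
next
  case (howe_Scdr p p' q)
  show ?case using howe_Scdr.IH[of \<sigma> \<tau>, OF howe_Scdr.prems] le_psub(2)[OF howe_Scdr.hyps(2), of \<tau>]
    by (auto intro: howe_trm_howe_stack.intros)
next
  case (howe_Scons M M' p p' q)
  show ?case using howe_Scons.IH(1)[of \<sigma> \<tau>, OF howe_Scons.prems] howe_Scons.IH(2)[of \<sigma> \<tau>, OF howe_Scons.prems]
      le_psub(2)[OF howe_Scons.hyps(3), of \<tau>]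
    by (auto intro: howe_trm_howe_stack.intros)
qed

lemma howe_subst0:
  assumes "howe_trm M N" "howe_stack p q"
  shows "howe_trm (subst_trm 0 p M) (subst_trm 0 q N)"
  unfolding subst0_eq_psub
  by (rule howe_psub(1)[OF assms(1)]) (use assms(2) in \<open>auto split: nat.split\<close>)

text \<open>Induction on the run. The left-hand constructor yields a matching term whose parts are
  related, the induction hypothesis runs that term, and \<open>le_conv\<close> absorbs the trailing
  \<open>le\<close>. The argument lists have to vary too, because \<open>App\<close> pushes related
  rather than equal stacks; \<open>conv_beta\<close> then uses substitutivity.\<close>

lemma howe_conv:
  "conv_trm M ps \<Longrightarrow> howe_trm M N \<Longrightarrow> list_all2 howe_stack ps qs \<Longrightarrow> conv_trm N qs"
  "conv_stack p n ps \<Longrightarrow> howe_stack p q \<Longrightarrow> list_all2 howe_stack ps qs \<Longrightarrow> conv_stack q n qs"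
proof (induction arbitrary: N qs and q qs rule: conv_trm_conv_stack.inducts)
  case (conv_App M p ps)
  from conv_App.prems(1) obtain M' p' where
    h: "howe_trm M M'" "howe_stack p p'" "le_trm (App M' p') N"
    by (rule howe_AppE)
  show ?case
    using conv_App.IH[OF h(1), of "p' # qs"] h(2) conv_App.prems(2) le_conv(1)[OF h(3)] by simp
next
  case (conv_beta p M ps)
  from conv_beta.prems(1) obtain M' where h: "howe_trm M M'" "le_trm (Mu M') N"
    by (rule howe_MuE)
  from conv_beta.prems(2) obtain p' qs' where
    q: "qs = p' # qs'" "howe_stack p p'" "list_all2 howe_stack ps qs'"
    by (auto simp: list_all2_Cons1)
  show ?case
    using conv_beta.IH[OF howe_subst0, OF h(1) q(2,3)] le_conv(1)[OF h(2)] q(1) by simp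
next
  case (conv_Mu M)
  from conv_Mu.prems(1) obtain M' where h: "howe_trm M M'" "le_trm (Mu M') N"
    by (rule howe_MuE)
  show ?case using conv_Mu.IH[OF h(1), of "[]"] le_conv(1)[OF h(2)] conv_Mu.prems(2) by simp
next
  case (conv_Car p ps)
  from conv_Car.prems(1) obtain p' where h: "howe_stack p p'" "le_trm (Car p') N"
    by (rule howe_CarE)
  show ?case using conv_Car.IH[OF h(1) conv_Car.prems(2)] le_conv(1)[OF h(2)] by simp
next
  case (conv_Scdr p n ps)
  from conv_Scdr.prems(1) obtain p' where h: "howe_stack p p'" "le_stack (Scdr p') q"
    by (rule howe_ScdrE)
  show ?case using conv_Scdr.IH[OF h(1) conv_Scdr.prems(2)] le_conv(2)[OF h(2)] by simp
next
  case (conv_Scons_0 M ps p)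
  from conv_Scons_0.prems(1) obtain M' p' where
    h: "howe_trm M M'" "howe_stack p p'" "le_stack (Scons M' p') q"
    by (rule howe_SconsE)
  show ?case using conv_Scons_0.IH[OF h(1) conv_Scons_0.prems(2)] le_conv(2)[OF h(3)] by simp
next
  case (conv_Scons_Suc p n ps M)
  from conv_Scons_Suc.prems(1) obtain M' p' where
    h: "howe_trm M M'" "howe_stack p p'" "le_stack (Scons M' p') q"
    by (rule howe_SconsE)
  show ?case using conv_Scons_Suc.IH[OF h(2) conv_Scons_Suc.prems(2)] le_conv(2)[OF h(3)] by simp
next
  case (conv_Svar i n ps)
  from conv_Svar.prems(1) have "le_stack (Svar i) q"
    by (rule howe_SvarE)
  then show ?case using le_conv(2) conv_simps(8) by blast
qed

lemma list_all2_howe_refl: "list_all2 howe_stack ps ps"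
  by (simp add: list.rel_refl)

text \<open>Instances of related expressions are related by \<open>howe_psub\<close>, and
  \<open>howe_conv\<close> transfers convergence. With \<open>le_imp_howe\<close> the closure
  coincides with \<open>le\<close>, which thereby inherits compatibility with the
  constructors.\<close>

lemma howe_imp_le:
  "howe_trm M N \<Longrightarrow> le_trm M N"
  "howe_stack p q \<Longrightarrow> le_stack p q"
  unfolding le_trm_def le_stack_def
  using howe_conv[OF _ _ list_all2_howe_refl] howe_psub[OF _ howe_refl(1)] by blast+

lemma le_imp_howe:
  "le_trm M N \<Longrightarrow> howe_trm M N"
  "le_stack p q \<Longrightarrow> howe_stack p q"
  using howe_le howe_refl by blast+

lemma le_Car: "le_stack p q \<Longrightarrow> le_trm (Car p) (Car q)"
  and le_Mu: "le_trm M N \<Longrightarrow> le_trm (Mu M) (Mu N)"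
  and le_App: "le_trm M N \<Longrightarrow> le_stack p q \<Longrightarrow> le_trm (App M p) (App N q)"
  and le_Scdr: "le_stack p q \<Longrightarrow> le_stack (Scdr p) (Scdr q)"
  and le_Scons: "le_trm M N \<Longrightarrow> le_stack p q \<Longrightarrow> le_stack (Scons M p) (Scons N q)"
  by (blast intro: howe_imp_le le_imp_howe howe_trm_howe_stack.intros le_refl)+

section \<open>The induced equivalence: a congruence containing conversion\<close>

definition eq_trm :: "trm \<Rightarrow> trm \<Rightarrow> bool" where
  "eq_trm M N \<longleftrightarrow> le_trm M N \<and> le_trm N M"

definition eq_stack :: "stack \<Rightarrow> stack \<Rightarrow> bool" where
  "eq_stack p q \<longleftrightarrow> le_stack p q \<and> le_stack q p"

lemma eq_refl [simp]: "eq_trm M M" "eq_stack p p"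
  by (simp_all add: eq_trm_def eq_stack_def)

lemma eq_sym: "eq_trm M N \<Longrightarrow> eq_trm N M" "eq_stack p q \<Longrightarrow> eq_stack q p"
  by (simp_all add: eq_trm_def eq_stack_def)

lemma eq_trans [trans]:
  "eq_trm M N \<Longrightarrow> eq_trm N P \<Longrightarrow> eq_trm M P"
  "eq_stack p q \<Longrightarrow> eq_stack q r \<Longrightarrow> eq_stack p r"
  unfolding eq_trm_def eq_stack_def using le_trans by blast+

lemma eq_Car: "eq_stack p q \<Longrightarrow> eq_trm (Car p) (Car q)"
  and eq_Mu: "eq_trm M N \<Longrightarrow> eq_trm (Mu M) (Mu N)"
  and eq_App: "eq_trm M N \<Longrightarrow> eq_stack p q \<Longrightarrow> eq_trm (App M p) (App N q)"
  and eq_Scdr: "eq_stack p q \<Longrightarrow> eq_stack (Scdr p) (Scdr q)"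
  and eq_Scons: "eq_trm M N \<Longrightarrow> eq_stack p q \<Longrightarrow> eq_stack (Scons M p) (Scons N q)"
  unfolding eq_trm_def eq_stack_def by (auto intro: le_Car le_Mu le_App le_Scdr le_Scons)

lemma eq_apps: "eq_trm M N \<Longrightarrow> eq_trm (apps M ps) (apps N ps)"
  by (induction ps arbitrary: M N) (simp_all add: eq_App)

lemma eq_fill: "eq_trm M N \<Longrightarrow> eq_trm (fill D M) (fill D N)"
  by (induction D) (simp_all add: eq_App eq_Mu)

lemma eq_trm_iff:
  "eq_trm M N \<longleftrightarrow> (\<forall>\<sigma> ps. conv_trm (psub_trm \<sigma> M) ps \<longleftrightarrow> conv_trm (psub_trm \<sigma> N) ps)"
  unfolding eq_trm_def le_trm_def by blast

lemma eq_stack_iff: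
  "eq_stack p q \<longleftrightarrow> (\<forall>\<sigma> n ps. conv_stack (psub_stack \<sigma> p) n ps \<longleftrightarrow> conv_stack (psub_stack \<sigma> q) n ps)"
  unfolding eq_stack_def le_stack_def by blast

lemma eq_conv: "eq_trm M N \<Longrightarrow> conv_trm M ps \<longleftrightarrow> conv_trm N ps"
  unfolding eq_trm_def using le_conv(1) by blast

text \<open>Once the substitution is pushed inwards, the machine steps for \<open>App\<close> and
  \<open>Mu\<close> lead from the left side to the configuration on the right.\<close>

lemma eq_beta: "eq_trm (App (Mu M) p) (subst_trm 0 p M)"
  by (simp add: eq_trm_iff subst0_psub_up psub_subst0)

lemma eq_Car_Scons: "eq_trm (Car (Scons M p)) M"
  by (simp add: eq_trm_iff)

lemma eq_Scdr_Scons: "eq_stack (Scdr (Scons M p)) p"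
  by (simp add: eq_stack_iff)

lemma red_imp_eq:
  "red_trm M N \<Longrightarrow> eq_trm M N"
  "red_stack p q \<Longrightarrow> eq_stack p q"
proof (induction rule: ctx_trm_ctx_stack.inducts)
  case (root_trm M N)
  then show ?case
    by (auto elim!: mu_rule.cases car_rule.cases intro: eq_beta eq_Car_Scons)
next
  case (root_stack p q)
  then show ?case by (auto elim!: cdr_rule.cases intro: eq_Scdr_Scons)
qed (auto intro: eq_Car eq_Mu eq_App eq_Scdr eq_Scons)

lemma equivclp_red_trm_imp_eq: "equivclp red_trm M N \<Longrightarrow> eq_trm M N"
  by (induct rule: equivclp_induct) (simp, metis red_imp_eq(1) eq_trans(1) eq_sym(1))

lemma equivclp_red_stack_imp_eq: "equivclp red_stack p q \<Longrightarrow> eq_stack p q"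
  by (induct rule: equivclp_induct) (simp, metis red_imp_eq(2) eq_trans(2) eq_sym(2))

lemma red_cc_imp_red:
  "ctx_trm car_rule cdr_rule M N \<Longrightarrow> red_trm M N"
  "ctx_stack car_rule cdr_rule p q \<Longrightarrow> red_stack p q"
  by (induction rule: ctx_trm_ctx_stack.inducts) (auto intro: ctx_trm_ctx_stack.intros)

lemma red_cc_rtranclp_imp_eq: "red_cc\<^sup>*\<^sup>* M N \<Longrightarrow> eq_trm M N"
  by (induction rule: rtranclp_induct) (auto intro: red_imp_eq red_cc_imp_red eq_trans)


section \<open>Canonical forms\<close>

text \<open>Smart constructors for the canonical form: on a normal argument the only possible redex
  is at the root, and they contract it.\<close>

fun car_nf :: "stack \<Rightarrow> trm" where
  "car_nf (Scons M p) = M"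
| "car_nf p = Car p"

fun cdr_nf :: "stack \<Rightarrow> stack" where
  "cdr_nf (Scons M p) = p"
| "cdr_nf p = Scdr p"

primrec nf_stack :: "stack \<Rightarrow> stack" and nf_trm :: "trm \<Rightarrow> trm" where
  "nf_stack Snil = Snil"
| "nf_stack (Svar i) = Svar i"
| "nf_stack (Scdr p) = cdr_nf (nf_stack p)"
| "nf_stack (Scons M p) = Scons (nf_trm M) (nf_stack p)"
| "nf_trm (Car p) = car_nf (nf_stack p)"
| "nf_trm (Mu M) = Mu (nf_trm M)"
| "nf_trm (App M p) = App (nf_trm M) (nf_stack p)"

abbreviation red_cc_stack :: "stack \<Rightarrow> stack \<Rightarrow> bool" where
  "red_cc_stack \<equiv> ctx_stack car_rule cdr_rule"

text \<open>As the function is constant along reduction, uniqueness of canonical forms can be read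
  off from it instead of from a confluence proof.\<close>

lemma nf_red_cc:
  "red_cc M N \<Longrightarrow> nf_trm M = nf_trm N"
  "red_cc_stack p q \<Longrightarrow> nf_stack p = nf_stack q"
  by (induction rule: ctx_trm_ctx_stack.inducts) (auto elim!: car_rule.cases cdr_rule.cases)

lemma nf_red_cc_rtranclp:
  "red_cc\<^sup>*\<^sup>* M N \<Longrightarrow> nf_trm M = nf_trm N"
  "red_cc_stack\<^sup>*\<^sup>* p q \<Longrightarrow> nf_stack p = nf_stack q"
  by (induct rule: rtranclp_induct; simp add: nf_red_cc)+

lemma size_red_cc:
  "red_cc M N \<Longrightarrow> size N < size M"
  "red_cc_stack p q \<Longrightarrow> size q < size p"
  by (induction rule: ctx_trm_ctx_stack.inducts) (auto elim!: car_rule.cases cdr_rule.cases)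

lemma size_red_cc_rtranclp: "red_cc\<^sup>*\<^sup>* M N \<Longrightarrow> size N \<le> size M"
  by (induction rule: rtranclp_induct) (auto dest: size_red_cc)

lemma rtranclp_map:
  assumes "\<And>x y. r x y \<Longrightarrow> s (f x) (f y)" and "r\<^sup>*\<^sup>* x y"
  shows "s\<^sup>*\<^sup>* (f x) (f y)"
  using assms(2) by (induction rule: rtranclp_induct) (auto intro: assms(1) rtranclp.rtrancl_into_rtrancl)

lemma red_cc_nf: "red_cc_stack\<^sup>*\<^sup>* p (nf_stack p)" "red_cc\<^sup>*\<^sup>* M (nf_trm M)"
proof (induction p and M rule: stack.induct trm.induct)
  case (Scdr p)
  have "red_cc_stack\<^sup>*\<^sup>* (Scdr p) (Scdr (nf_stack p))"
    by (rule rtranclp_map[where f = Scdr, OF _ Scdr]) (rule ctx_Scdr)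
  also have "red_cc_stack\<^sup>*\<^sup>* (Scdr (nf_stack p)) (cdr_nf (nf_stack p))"
    by (cases "nf_stack p") (auto intro!: r_into_rtranclp root_stack cdr_rule.intros)
  finally show ?case by simp
next
  case (Scons M p)
  have "red_cc_stack\<^sup>*\<^sup>* (Scons M p) (Scons (nf_trm M) p)"
    by (rule rtranclp_map[where f = "\<lambda>M. Scons M p", OF _ Scons(1)]) (rule ctx_Scons1)
  also have "red_cc_stack\<^sup>*\<^sup>* (Scons (nf_trm M) p) (Scons (nf_trm M) (nf_stack p))"
    by (rule rtranclp_map[where f = "Scons (nf_trm M)", OF _ Scons(2)]) (rule ctx_Scons2)
  finally show ?case by simp
next
  case (Car p)
  have "red_cc\<^sup>*\<^sup>* (Car p) (Car (nf_stack p))"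
    by (rule rtranclp_map[where f = Car, OF _ Car]) (rule ctx_Car)
  also have "red_cc\<^sup>*\<^sup>* (Car (nf_stack p)) (car_nf (nf_stack p))"
    by (cases "nf_stack p") (auto intro!: r_into_rtranclp root_trm car_rule.intros)
  finally show ?case by simp
next
  case (Mu M)
  have "red_cc\<^sup>*\<^sup>* (Mu M) (Mu (nf_trm M))"
    by (rule rtranclp_map[where f = Mu, OF _ Mu]) (rule ctx_Mu)
  then show ?case by simp
next
  case (App M p)
  have "red_cc\<^sup>*\<^sup>* (App M p) (App (nf_trm M) p)"
    by (rule rtranclp_map[where f = "\<lambda>M. App M p", OF _ App(1)]) (rule ctx_App1)
  also have "red_cc\<^sup>*\<^sup>* (App (nf_trm M) p) (App (nf_trm M) (nf_stack p))"
    by (rule rtranclp_map[where f = "App (nf_trm M)", OF _ App(2)]) (rule ctx_App2)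
  finally show ?case by simp
qed simp_all

lemma nf_nf_stack: "nf_stack (nf_stack p) = nf_stack p"
  using nf_red_cc_rtranclp(2)[OF red_cc_nf(1)] by (rule sym)

text \<open>A reduct \<open>P\<close> of \<open>nf_trm M\<close> would itself normalise to
  \<open>nf_trm M\<close>, so it could not be smaller, whereas every contraction strictly shrinks
  the term.\<close>

lemma nf_trm_normal: "\<not> red_cc (nf_trm M) P"
proof
  assume red: "red_cc (nf_trm M) P"
  have "nf_trm P = nf_trm M"
    using nf_red_cc(1)[OF red] nf_red_cc_rtranclp(1)[OF red_cc_nf(2)] by metis
  then show False
    using size_red_cc(1)[OF red] size_red_cc_rtranclp[OF red_cc_nf(2)[of P]] by simp
qed

lemma canonical_form_iff: "canonical_form M N \<longleftrightarrow> N = nf_trm M"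
proof
  assume c: "canonical_form M N"
  then have "nf_trm M = nf_trm N"
    using nf_red_cc_rtranclp(1) by (auto simp: canonical_form_def)
  moreover have "nf_trm N = N"
    using c red_cc_nf(2)[of N] by (metis canonical_form_def converse_rtranclpE)
  ultimately show "N = nf_trm M" by simp
qed (simp add: canonical_form_def red_cc_nf nf_trm_normal)

lemma nf_psub_car_nf: "nf_trm (psub_trm \<sigma> (car_nf p)) = car_nf (nf_stack (psub_stack \<sigma> p))"
  and nf_psub_cdr_nf: "nf_stack (psub_stack \<sigma> (cdr_nf p)) = cdr_nf (nf_stack (psub_stack \<sigma> p))"
  by (cases p; simp)+

text \<open>A renaming puts variables for variables and so exposes no new \<open>Scons\<close>; this
  is why canonical forms commute with renaming in \<open>nf_ren\<close>.\<close>

lemma ren_car_nf: "psub_trm (\<lambda>i. Svar (r i)) (car_nf p) = car_nf (psub_stack (\<lambda>i. Svar (r i)) p)"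
  and ren_cdr_nf: "psub_stack (\<lambda>i. Svar (r i)) (cdr_nf p) = cdr_nf (psub_stack (\<lambda>i. Svar (r i)) p)"
  by (cases p; simp)+

lemma nf_ren:
  "nf_stack (psub_stack (\<lambda>i. Svar (r i)) p) = psub_stack (\<lambda>i. Svar (r i)) (nf_stack p)"
  "nf_trm (psub_trm (\<lambda>i. Svar (r i)) M) = psub_trm (\<lambda>i. Svar (r i)) (nf_trm M)"
  by (induction p and M arbitrary: r and r rule: stack.induct trm.induct)
    (simp_all add: ren_car_nf ren_cdr_nf up_ren)

text \<open>Substituted stacks may create new \<open>Car\<close> and \<open>Scdr\<close> redexes,
  hence the outer normalisation on the left; normalising the ingredients beforehand does not change
  the result.\<close>

lemma nf_psub:
  "nf_stack (psub_stack (\<lambda>i. nf_stack (\<sigma> i)) (nf_stack p)) = nf_stack (psub_stack \<sigma> p)"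
  "nf_trm (psub_trm (\<lambda>i. nf_stack (\<sigma> i)) (nf_trm M)) = nf_trm (psub_trm \<sigma> M)"
proof (induction p and M arbitrary: \<sigma> and \<sigma> rule: stack.induct trm.induct)
  case (Svar i)
  show ?case by (simp add: nf_nf_stack)
next
  case (Mu M)
  have "(\<lambda>i. nf_stack (up \<sigma> i)) = up (\<lambda>i. nf_stack (\<sigma> i))"
  proof
    fix i
    show "nf_stack (up \<sigma> i) = up (\<lambda>i. nf_stack (\<sigma> i)) i"
      by (cases i) (simp_all add: lift0_eq_psub nf_ren)
  qed
  then show ?case using Mu[of "up \<sigma>"] by simp
qed (simp_all add: nf_psub_car_nf nf_psub_cdr_nf)

lemma nf_subst0: "nf_trm (subst_trm 0 (nf_stack p) (nf_trm M)) = nf_trm (subst_trm 0 p M)"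
proof -
  have "(\<lambda>i. nf_stack (case_nat p Svar i)) = case_nat (nf_stack p) Svar"
    by (rule ext) (simp split: nat.split)
  then show ?thesis using nf_psub(2)[of "case_nat p Svar" M] by (simp add: subst0_eq_psub)
qed

lemma nf_apps: "nf_trm (apps M ps) = apps (nf_trm M) (map nf_stack ps)"
  by (induction ps arbitrary: M) simp_all

lemma nf_Scdr_funpow_Svar: "nf_stack ((Scdr ^^ n) (Svar i)) = (Scdr ^^ n) (Svar i)"
proof (induction n)
  case (Suc n)
  then show ?case by (cases n) simp_all
qed simp

lemma nf_Scdr_funpow_cong:
  "nf_stack p = nf_stack q \<Longrightarrow> nf_stack ((Scdr ^^ n) p) = nf_stack ((Scdr ^^ n) q)"
  by (induction n) simp_all


section \<open>Convergence is having a proper head normal form\<close>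

lemma proper_hnf_cong: "nf_trm M = nf_trm N \<Longrightarrow> proper_hnf M \<longleftrightarrow> proper_hnf N"
  by (simp add: proper_hnf_def canonical_form_iff)

lemma head_red_iff:
  "head_red M P \<longleftrightarrow> (\<exists>n N q ps. nf_trm M = mus n (apps (App (Mu N) q) ps) \<and>
     P = mus n (apps (subst_trm 0 q N) ps))"
proof
  assume "head_red M P"
  then show "\<exists>n N q ps. nf_trm M = mus n (apps (App (Mu N) q) ps) \<and>
     P = mus n (apps (subst_trm 0 q N) ps)"
    by cases (metis canonical_form_iff)
next
  assume "\<exists>n N q ps. nf_trm M = mus n (apps (App (Mu N) q) ps) \<and>
     P = mus n (apps (subst_trm 0 q N) ps)"
  then obtain n N q ps where "canonical_form M (mus n (apps (App (Mu N) q) ps))"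
      "P = mus n (apps (subst_trm 0 q N) ps)"
    by (auto simp: canonical_form_iff)
  then show "head_red M P"
    using head_red.intros by blast
qed

lemma has_proper_hnf_iff:
  "has_proper_hnf M \<longleftrightarrow> proper_hnf M \<or> (\<exists>N. head_red M N \<and> has_proper_hnf N)"
  unfolding has_proper_hnf_def
  by (auto elim: converse_rtranclpE intro: converse_rtranclp_into_rtranclp)

lemma has_proper_hnf_cong:
  assumes "nf_trm M = nf_trm N"
  shows "has_proper_hnf M \<longleftrightarrow> has_proper_hnf N"
proof -
  have "head_red M = head_red N"
    by (rule ext) (simp only: head_red_iff assms)
  then show ?thesis
    using has_proper_hnf_iff[of M] has_proper_hnf_iff[of N] proper_hnf_cong[OF assms] by metis
qed

lemma has_proper_hnf_Mu: "has_proper_hnf M \<Longrightarrow> has_proper_hnf (Mu M)"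
proof -
  assume "has_proper_hnf M"
  then obtain N where N: "head_red\<^sup>*\<^sup>* M N" "proper_hnf N"
    by (auto simp: has_proper_hnf_def)
  have "head_red (Mu P) (Mu Q)" if "head_red P Q" for P Q
    using that unfolding head_red_iff by (metis mus_simps(2) nf_trm.simps(2))
  then have "head_red\<^sup>*\<^sup>* (Mu M) (Mu N)"
    using N(1) by (rule rtranclp_map)
  moreover have "proper_hnf (Mu N)"
    using N(2) unfolding proper_hnf_def canonical_form_iff by (metis mus_simps(2) nf_trm.simps(2))
  ultimately show ?thesis by (auto simp: has_proper_hnf_def)
qed

text \<open>A head step contracts the canonical form instead of the term as written. The two reducts
  may differ, but by \<open>nf_subst0\<close> they share a canonical form, and
  \<open>has_proper_hnf\<close> depends only on that.\<close>

lemma has_proper_hnf_beta: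
  assumes "has_proper_hnf (apps (subst_trm 0 p M) ps)"
  shows "has_proper_hnf (apps (App (Mu M) p) ps)"
proof -
  let ?N = "apps (subst_trm 0 (nf_stack p) (nf_trm M)) (map nf_stack ps)"
  have "nf_trm ?N = nf_trm (apps (subst_trm 0 p M) ps)"
    by (simp add: nf_apps nf_subst0 nf_nf_stack o_def)
  then have "has_proper_hnf ?N"
    using assms has_proper_hnf_cong by blast
  moreover have "head_red (apps (App (Mu M) p) ps) ?N"
  proof -
    have "canonical_form (apps (App (Mu M) p) ps)
        (mus 0 (apps (App (Mu (nf_trm M)) (nf_stack p)) (map nf_stack ps)))"
      by (simp add: canonical_form_iff nf_apps)
    from head_red.intros[OF this] show ?thesis by simp
  qed
  ultimately show ?thesis
    using has_proper_hnf_iff by blast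
qed

lemma car_n_Scdr: "car_n n (Scdr p) = car_n (Suc n) p"
  by (simp add: car_n_def funpow_swap1)

text \<open>Only \<open>conv_beta\<close> corresponds to a head step. The stack-access rules leave
  the canonical form unchanged, \<open>conv_Mu\<close> lengthens the binder prefix, and
  \<open>conv_Svar\<close> is a proper head normal form.\<close>

lemma conv_imp_has_proper_hnf:
  "conv_trm M ps \<Longrightarrow> has_proper_hnf (apps M ps)"
  "conv_stack p n ps \<Longrightarrow> has_proper_hnf (apps (car_n n p) ps)"
proof (induction rule: conv_trm_conv_stack.inducts)
  case (conv_Scons_0 M ps p)
  have "nf_trm (apps (car_n 0 (Scons M p)) ps) = nf_trm (apps M ps)"
    by (simp add: nf_apps car_n_def)
  then show ?case using conv_Scons_0.IH has_proper_hnf_cong by blast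
next
  case (conv_Scons_Suc p n ps M)
  have "nf_stack ((Scdr ^^ Suc n) (Scons M p)) = nf_stack ((Scdr ^^ n) p)"
    \<comment> \<open>This form singles out the innermost \<open>Scdr\<close>, the one that meets
      \<open>Scons\<close>.\<close>
    unfolding funpow_Suc_right o_apply by (rule nf_Scdr_funpow_cong) simp
  then have "nf_trm (apps (car_n (Suc n) (Scons M p)) ps) = nf_trm (apps (car_n n p) ps)"
    by (simp only: nf_apps car_n_def nf_trm.simps)
  then show ?case using conv_Scons_Suc.IH has_proper_hnf_cong by blast
next
  case (conv_Svar i n ps)
  have "car_nf ((Scdr ^^ n) (Svar i)) = Car ((Scdr ^^ n) (Svar i))"
    by (cases n) simp_all
  then have "nf_trm (apps (car_n n (Svar i)) ps) = mus 0 (apps (car_n n (Svar i)) (map nf_stack ps))"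
    by (simp add: nf_apps car_n_def nf_Scdr_funpow_Svar)
  then have "proper_hnf (apps (car_n n (Svar i)) ps)"
    unfolding proper_hnf_def canonical_form_iff by (intro exI) (rule sym)
  then show ?case using has_proper_hnf_iff by blast
next
  case (conv_Scdr p n ps)
  then show ?case by (simp only: car_n_Scdr)
qed (simp_all add: has_proper_hnf_beta has_proper_hnf_Mu car_n_def)

lemma eq_canonical_form: "canonical_form M N \<Longrightarrow> eq_trm M N"
  by (simp add: canonical_form_def red_cc_rtranclp_imp_eq)

lemma eq_mus: "eq_trm M N \<Longrightarrow> eq_trm (mus n M) (mus n N)"
  by (induction n) (simp_all add: eq_Mu)

lemma head_red_imp_eq: "head_red M N \<Longrightarrow> eq_trm M N"
  by (erule head_red.cases) (use eq_trans(1)[OF eq_canonical_form eq_mus[OF eq_apps[OF eq_beta]]] in simp)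

text \<open>From left to right: head steps are equalities for \<open>eq_trm\<close>, which preserves
  convergence, so it is enough that proper head normal forms converge.\<close>

lemma has_proper_hnf_iff_conv: "has_proper_hnf M \<longleftrightarrow> conv_trm M []"
proof
  assume "has_proper_hnf M"
  then obtain N where N: "head_red\<^sup>*\<^sup>* M N" "proper_hnf N"
    by (auto simp: has_proper_hnf_def)
  from N(1) have "eq_trm M N"
    by (induction rule: rtranclp_induct) (auto intro: eq_trans head_red_imp_eq)
  moreover have "conv_trm N []"
    using N(2) eq_conv eq_canonical_form by (fastforce simp: proper_hnf_def conv_mus_Nil car_n_def)
  ultimately show "conv_trm M []"
    using eq_conv by blast
next
  assume "conv_trm M []"
  then show "has_proper_hnf M"
    using conv_imp_has_proper_hnf(1) by fastforce
qed


section \<open>Operational equivalence\<close>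

text \<open>The outermost of the \<open>n\<close> binders owns index \<open>n - 1\<close> in
  \<open>M\<close> and takes the first argument, hence the reversal. Indices from \<open>n\<close>
  on point past the binders and are left to \<open>\<sigma>\<close>.\<close>

lemma eq_apps_mus:
  "eq_trm (apps (psub_trm \<sigma> (mus n M)) (rev (map \<tau> [0..<n])))
     (psub_trm (\<lambda>i. if i < n then \<tau> i else \<sigma> (i - n)) M)"
proof (induction n arbitrary: \<sigma>)
  case (Suc n)
  have "eq_trm (apps (psub_trm \<sigma> (mus (Suc n) M)) (rev (map \<tau> [0..<Suc n])))
      (apps (psub_trm (case_nat (\<tau> n) \<sigma>) (mus n M)) (rev (map \<tau> [0..<n])))"
    using eq_apps[OF eq_beta[of "psub_trm (up \<sigma>) (mus n M)" "\<tau> n"]] by (simp add: subst0_psub_up)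
  also have "eq_trm \<dots>
      (psub_trm (\<lambda>i. if i < n then \<tau> i else case_nat (\<tau> n) \<sigma> (i - n)) M)"
    by (rule Suc)
  also have "(\<lambda>i. if i < n then \<tau> i else case_nat (\<tau> n) \<sigma> (i - n)) =
      (\<lambda>i. if i < Suc n then \<tau> i else \<sigma> (i - Suc n))"
    by (rule ext) (auto split: nat.split simp: less_Suc_eq intro: arg_cong[of _ _ \<sigma>])
  finally show ?case .
qed simp

lemma eq_apps_mus_bound:
  assumes "bound_trm M \<le> n"
  shows "eq_trm (apps (mus n M) (rev (map \<tau> [0..<n]))) (psub_trm \<tau> M)"
proof -
  have "psub_trm (\<lambda>i. if i < n then \<tau> i else Svar (i - n)) M = psub_trm \<tau> M"
    by (rule psub_cong_bound) (use assms in auto)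
  then show ?thesis using eq_apps_mus[of Svar n M \<tau>] by simp
qed

lemma ex_fill_apps_mus: "\<exists>D. \<forall>M. fill D M = apps (mus n M) ps"
proof -
  have mus: "\<exists>D. \<forall>M. fill D M = mus n M"
  proof (induction n)
    case 0
    show ?case by (rule exI[of _ Hole]) simp
  next
    case (Suc n)
    then obtain D where "\<forall>M. fill D M = mus n M" ..
    then show ?case by (intro exI[of _ "HMu D"]) simp
  qed
  show ?thesis
  \<comment> \<open>Induction from the right, because \<open>HApp\<close> adds its stack as the last
    argument.\<close>
  proof (induction ps rule: rev_induct)
    case Nil
    then show ?case using mus by simp
  next
    case (snoc p ps)
    then obtain D where "\<forall>M. fill D M = apps (mus n M) ps" ..
    then show ?case by (intro exI[of _ "HApp D p"]) (simp add: apps_append)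
  qed
qed

lemma op_equiv_iff_eq: "op_equiv M N \<longleftrightarrow> eq_trm M N"
proof
  assume "eq_trm M N"
  then show "op_equiv M N"
    unfolding op_equiv_def has_proper_hnf_iff_conv using eq_fill eq_conv by blast
next
  assume op: "op_equiv M N"
  show "eq_trm M N"
    unfolding eq_trm_iff
  proof (intro allI)
    fix \<sigma> ps
    \<comment> \<open>A common bound lets a single context serve both terms: it captures all their
      free variables, supplies the values of \<open>\<sigma>\<close>, and then applies to
      \<open>ps\<close>.\<close>
    let ?n = "max (bound_trm M) (bound_trm N)"
    obtain D where D: "fill D P = apps (mus ?n P) (rev (map \<sigma> [0..<?n]) @ ps)" for P
      using ex_fill_apps_mus by blast
    have "conv_trm (fill D P) [] \<longleftrightarrow> conv_trm (psub_trm \<sigma> P) ps" if "bound_trm P \<le> ?n" for P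
      using eq_conv[OF eq_apps_mus_bound[OF that, of \<sigma>], of ps] by (simp add: D del: rev_map)
    from this[of M] this[of N] show "conv_trm (psub_trm \<sigma> M) ps \<longleftrightarrow> conv_trm (psub_trm \<sigma> N) ps"
      using op by (simp add: op_equiv_def has_proper_hnf_iff_conv)
  qed
qed

lemma op_equiv_stack_iff_eq: "op_equiv_stack p q \<longleftrightarrow> eq_stack p q"
proof
  assume "eq_stack p q"
  then show "op_equiv_stack p q"
    by (simp add: op_equiv_stack_def op_equiv_iff_eq eq_App)
next
  assume op: "op_equiv_stack p q"
  show "eq_stack p q"
    unfolding eq_stack_iff
  proof (intro allI)
    fix \<sigma> n ps
    \<comment> \<open>The projection \<mu>\<alpha>. \<open>car_n n\<close> \<alpha> turns the
      observation of component \<open>n\<close> of a stack into an application, as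
      \<open>op_equiv_stack\<close> requires.\<close>
    have "conv_trm (psub_trm \<sigma> (App (Mu (car_n n (Svar 0))) r)) ps \<longleftrightarrow> conv_stack (psub_stack \<sigma> r) n ps" for r
    proof -
      have "psub_stack \<tau> ((Scdr ^^ n) (Svar 0)) = (Scdr ^^ n) (\<tau> 0)" for \<tau>
        by (induction n) simp_all
      moreover have "subst_stack 0 q ((Scdr ^^ n) (Svar 0)) = (Scdr ^^ n) q" for q
        by (induction n) simp_all
      ultimately show ?thesis by (simp add: car_n_def)
    qed
    then show "conv_stack (psub_stack \<sigma> p) n ps \<longleftrightarrow> conv_stack (psub_stack \<sigma> q) n ps"
      using op unfolding op_equiv_stack_def op_equiv_iff_eq eq_trm_iff by metis
  qed
qed

lemma equational_theory_op_equivalence: "equational_theory op_equivalence"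
  unfolding equational_theory_def op_equivalence_def conversion_def op_equiv_iff_eq
    op_equiv_stack_iff_eq
  by (auto intro: equivclp_red_trm_imp_eq equivclp_red_stack_imp_eq eq_sym eq_trans eq_Car eq_Mu eq_App eq_Scdr eq_Scons)

lemma not_inconsistent_op_equivalence: "\<not> inconsistent op_equivalence"
proof
  assume "inconsistent op_equivalence"
  \<comment> \<open>The witnesses are a variable head, which converges, and a \<open>Snil\<close>
    head, which does not; the surrounding binder and argument leave this unchanged.\<close>
  then have "eq_trm (Mu (App (lift_trm 0 (Car (Svar 0))) (Svar 0)))
      (Mu (App (lift_trm 0 (Car Snil)) (Svar 0)))"
    by (simp only: inconsistent_def op_equivalence_def op_equiv_iff_eq) blast
  from eq_conv[OF this, of "[]"] show False by simp
qed


section \<open>Maximality\<close>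

text \<open>The witness is \<open>P\<close> under \<open>n\<close> vacuous binders, each of which
  discards one argument.\<close>

lemma ex_constant_trm: "\<exists>X. \<forall>ps. length ps = n \<longrightarrow> eq_trm (apps X ps) P"
proof (induction n)
  case 0
  show ?case by (rule exI[of _ P]) simp
next
  case (Suc n)
  then obtain X where X: "\<forall>ps. length ps = n \<longrightarrow> eq_trm (apps X ps) P" ..
  have "eq_trm (App (Mu (lift_trm 0 X)) p) X" for p
    using eq_beta[of "lift_trm 0 X" p] by (simp add: subst0_eq_psub lift0_eq_psub psub_ren)
  then have "eq_trm (apps (Mu (lift_trm 0 X)) ps) P" if "length ps = Suc n" for ps
    using X that eq_trans(1) eq_apps by (fastforce simp: length_Suc_conv)
  then show ?case by blast
qed

lemma eq_Scdr_funpow: "eq_stack p q \<Longrightarrow> eq_stack ((Scdr ^^ n) p) ((Scdr ^^ n) q)"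
  by (induction n) (simp_all add: eq_Scdr)

lemma eq_car_n_Scons:
  "eq_trm (car_n 0 (Scons M p)) M" "eq_trm (car_n (Suc n) (Scons M p)) (car_n n p)"
  unfolding car_n_def funpow_Suc_right
  by (simp_all add: eq_Car_Scons eq_Car eq_Scdr_funpow eq_Scdr_Scons)

text \<open>Components are counted from 0, so \<open>Suc n\<close> copies of \<open>M\<close> reach
  component \<open>n\<close>.\<close>

lemma eq_car_n_repeat: "eq_trm (car_n n ((Scons M ^^ Suc n) p)) M"
proof (induction n)
  case 0
  show ?case by (simp add: eq_car_n_Scons)
next
  case (Suc n)
  then show ?case
    using eq_trans(1)[OF eq_car_n_Scons(2)] by (metis funpow.simps(2) o_apply)
qed

text \<open>Solvability: a suitable substitution and extra arguments turn a convergent configuration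
  into any prescribed \<open>P\<close>. They are built backwards along the run, starting from the
  variable at which it stops.\<close>

lemma conv_solvable:
  "conv_trm M ps \<Longrightarrow> \<exists>\<sigma> qs. eq_trm (apps (psub_trm \<sigma> M) (map (psub_stack \<sigma>) ps @ qs)) P"
  "conv_stack p n ps \<Longrightarrow>
    \<exists>\<sigma> qs. eq_trm (apps (car_n n (psub_stack \<sigma> p)) (map (psub_stack \<sigma>) ps @ qs)) P"
proof (induction rule: conv_trm_conv_stack.inducts)
  case (conv_App M p ps)
  then show ?case by simp
next
  case (conv_beta p M ps)
  then obtain \<sigma> qs where
    "eq_trm (apps (psub_trm \<sigma> (subst_trm 0 p M)) (map (psub_stack \<sigma>) ps @ qs)) P" by blast
  moreover have "eq_trm (App (psub_trm \<sigma> (Mu M)) (psub_stack \<sigma> p)) (psub_trm \<sigma> (subst_trm 0 p M))"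
    using eq_beta[of "psub_trm (up \<sigma>) M" "psub_stack \<sigma> p"] by (simp add: subst0_psub_up psub_subst0)
  ultimately have "eq_trm (apps (psub_trm \<sigma> (Mu M)) (map (psub_stack \<sigma>) (p # ps) @ qs)) P"
    using eq_trans(1) eq_apps by (simp del: psub_trm.simps) blast
  then show ?case by blast
next
  case (conv_Mu M)
  then obtain \<sigma> qs where *: "eq_trm (apps (psub_trm \<sigma> M) qs) P" by auto
  \<comment> \<open>The value of \<open>\<sigma>\<close> at the bound index becomes the first extra
    argument, and the remaining values move down by one.\<close>
  have "case_nat (\<sigma> 0) (\<lambda>i. \<sigma> (Suc i)) = \<sigma>"
    by (rule ext) (simp split: nat.split)
  then have "eq_trm (App (psub_trm (\<lambda>i. \<sigma> (Suc i)) (Mu M)) (\<sigma> 0)) (psub_trm \<sigma> M)"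
    using eq_beta[of "psub_trm (up (\<lambda>i. \<sigma> (Suc i))) M" "\<sigma> 0"] by (simp add: subst0_psub_up)
  then have "eq_trm (apps (psub_trm (\<lambda>i. \<sigma> (Suc i)) (Mu M)) (map (psub_stack (\<lambda>i. \<sigma> (Suc i))) [] @ \<sigma> 0 # qs)) P"
    using * eq_trans(1) eq_apps by (simp del: psub_trm.simps) blast
  then show ?case by blast
next
  case (conv_Car p ps)
  then show ?case by (simp add: car_n_def)
next
  case (conv_Scdr p n ps)
  then show ?case by (simp add: car_n_Scdr)
next
  case (conv_Scons_0 M ps p)
  then show ?case using eq_trans(1)[OF eq_apps[OF eq_car_n_Scons(1)]] by (simp, blast)
next
  case (conv_Scons_Suc p n ps M)
  then show ?case using eq_trans(1)[OF eq_apps[OF eq_car_n_Scons(2)]] by (simp, blast)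
next
  case (conv_Svar i n ps)
  obtain X where X: "\<And>qs. length qs = length ps \<Longrightarrow> eq_trm (apps X qs) P"
    using ex_constant_trm by blast
  \<comment> \<open>Every variable is sent to a stack of copies of \<open>X\<close>. Component
    \<open>n\<close> is then \<open>X\<close>, which discards exactly the \<open>length ps\<close>
    arguments present.\<close>
  let ?\<sigma> = "\<lambda>_. (Scons X ^^ Suc n) Snil"
  have "eq_trm (apps (car_n n (psub_stack ?\<sigma> (Svar i))) (map (psub_stack ?\<sigma>) ps @ [])) P"
    using eq_trans(1)[OF eq_apps[OF eq_car_n_repeat] X, of "map (psub_stack ?\<sigma>) ps"]
    by simp
  then show ?case by blast
qed

text \<open>Neither term has a convergent instance, by \<open>conv_psub_imp_conv\<close>, so no
  observation separates them.\<close>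

lemma not_conv_eq:
  assumes "\<not> conv_trm M []" "\<not> conv_trm N []"
  shows "eq_trm M N"
proof -
  have "\<not> conv_trm (psub_trm \<sigma> P) ps" if "\<not> conv_trm P []" for \<sigma> P ps
    using that conv_psub_imp_conv(1)[of _ ps \<sigma> P "[]" ps] by auto
  then show ?thesis using assms by (simp add: eq_trm_iff)
qed

lemma not_conv_apps_mus:
  assumes "\<not> conv_trm N []"
  shows "\<not> conv_trm (apps (mus n N) ps) []"
proof -
  have "\<not> conv_trm (mus n N) []"
    using assms by (simp add: conv_mus_Nil)
  then have "\<not> conv_trm (psub_trm Svar (mus n N)) ps"
    using conv_psub_imp_conv(1)[of _ ps Svar "mus n N" "[]" ps] by auto
  then show ?thesis by simp
qed

section \<open>Theories extending operational equivalence on terms\<close>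

lemma equational_theoryD:
  assumes "equational_theory T"
  shows "conversion \<subseteq> T"
    and "\<forall>M N. TEq M N \<in> T \<longrightarrow> TEq N M \<in> T"
    and "\<forall>M N P. TEq M N \<in> T \<longrightarrow> TEq N P \<in> T \<longrightarrow> TEq M P \<in> T"
    and "\<forall>M N. TEq M N \<in> T \<longrightarrow> TEq (Mu M) (Mu N) \<in> T"
    and "\<forall>M N p q. TEq M N \<in> T \<longrightarrow> SEq p q \<in> T \<longrightarrow> TEq (App M p) (App N q) \<in> T"
  by (insert assms, unfold equational_theory_def, elim conjE, assumption)+

lemma conversion_refl: "TEq M M \<in> conversion" "SEq p p \<in> conversion"
  by (simp_all add: conversion_def)

locale eq_theory =
  fixes T
  assumes equational: "equational_theory T"
    and eq_imp_T: "eq_trm M N \<Longrightarrow> TEq M N \<in> T"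
begin

lemma T_sym: "TEq M N \<in> T \<Longrightarrow> TEq N M \<in> T"
  using equational_theoryD(2)[OF equational] by blast

lemma T_trans: "TEq M N \<in> T \<Longrightarrow> TEq N P \<in> T \<Longrightarrow> TEq M P \<in> T"
  using equational_theoryD(3)[OF equational] by blast

lemma T_Mu: "TEq M N \<in> T \<Longrightarrow> TEq (Mu M) (Mu N) \<in> T"
  using equational_theoryD(4)[OF equational] by blast

lemma T_App: "TEq M N \<in> T \<Longrightarrow> SEq p q \<in> T \<Longrightarrow> TEq (App M p) (App N q) \<in> T"
  using equational_theoryD(5)[OF equational] by blast

lemma T_refl: "TEq M M \<in> T" "SEq p p \<in> T"
  using equational_theoryD(1)[OF equational] conversion_refl by blast+

lemma T_fill: "TEq M N \<in> T \<Longrightarrow> TEq (fill D M) (fill D N) \<in> T"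
  by (induction D) (simp_all add: T_Mu T_App T_refl)

text \<open>One head context \<open>D\<close> is used on both sides. It simulates the substitution
  and arguments that solve \<open>M\<close>, so it sends \<open>M\<close> to \<open>P\<close>, while
  \<open>N\<close> stays divergent and is thus equal to \<open>Car Snil\<close>.\<close>

lemma T_collapse:
  assumes "TEq M N \<in> T" "conv_trm M []" "\<not> conv_trm N []"
  shows "TEq P (Car Snil) \<in> T"
proof -
  obtain \<sigma> qs where "eq_trm (apps (psub_trm \<sigma> M) qs) P"
    using conv_solvable(1)[OF assms(2), of P] by auto
  then have P: "eq_trm (apps (mus (bound_trm M) M) (rev (map \<sigma> [0..<bound_trm M]) @ qs)) P"
    using eq_trans(1)[OF eq_apps[OF eq_apps_mus_bound[OF order_refl]]] by (simp add: apps_append)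
  obtain D where D: "fill D Q = apps (mus (bound_trm M) Q) (rev (map \<sigma> [0..<bound_trm M]) @ qs)" for Q
    using ex_fill_apps_mus by blast
  have "eq_trm (fill D N) (Car Snil)"
    using not_conv_apps_mus[OF assms(3)] by (intro not_conv_eq) (simp_all only: D conv_simps not_False_eq_True)
  then show ?thesis
    using P T_fill[OF assms(1), of D] D eq_imp_T T_sym T_trans by metis
qed

lemma T_inconsistent:
  assumes "TEq M N \<in> T" "\<not> eq_trm M N"
  shows "inconsistent T"
proof -
  from assms(2) obtain D where "conv_trm (fill D M) [] \<noteq> conv_trm (fill D N) []"
    unfolding op_equiv_iff_eq[symmetric] op_equiv_def has_proper_hnf_iff_conv by blast
  \<comment> \<open>Either filled term may be the convergent one; symmetry of \<open>T\<close>
    covers both cases.\<close>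
  then have "TEq P (Car Snil) \<in> T" for P
    using T_collapse T_fill[OF assms(1), of D] T_sym by metis
  then show ?thesis
    unfolding inconsistent_def using T_sym T_trans by blast
qed

end

theorem theorem5:
  shows "hilbert_post_complete op_equivalence \<and>
    (\<forall>T. equational_theory T \<longrightarrow>
      {(M, N). op_equiv M N} \<subset> {(M, N). TEq M N \<in> T} \<longrightarrow> inconsistent T)"
proof -
  have terms: "inconsistent T"
    if T: "equational_theory T" and sub: "{(M, N). op_equiv M N} \<subset> {(M, N). TEq M N \<in> T}" for T
  proof -
    interpret eq_theory T
      using T sub by unfold_locales (auto simp: op_equiv_iff_eq)
    show ?thesis
      using sub T_inconsistent by (auto simp: op_equiv_iff_eq)
  qed
  moreover have "inconsistent T" if T: "equational_theory T" and sub: "op_equivalence \<subset> T" for T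
  proof -
    have sub_trm: "{(M, N). op_equiv M N} \<subseteq> {(M, N). TEq M N \<in> T}"
      using sub by (auto simp: op_equivalence_def)
    have "\<exists>M N. TEq M N \<in> T \<and> \<not> op_equiv M N"
    proof -
      obtain e where e: "e \<in> T" "e \<notin> op_equivalence" using sub by blast
      show ?thesis
      proof (cases e)
        case (TEq M N)
        then show ?thesis using e by (auto simp: op_equivalence_def)
      next
        case (SEq p q)
        \<comment> \<open>A new equation between stacks yields a new one between terms: some
          \<open>M\<close> separates the stacks operationally, while the theory equates its
          applications to them.\<close>
        then obtain M where M: "\<not> op_equiv (App M p) (App M q)"
          using e by (auto simp: op_equivalence_def op_equiv_stack_def)
        have "TEq M M \<in> T"
          using equational_theoryD(1)[OF T] conversion_refl(1) by blast
        then have "TEq (App M p) (App M q) \<in> T"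
          using equational_theoryD(5)[OF T] e(1) SEq by blast
        then show ?thesis using M by blast
      qed
    qed
    then show ?thesis using terms[OF T] sub_trm by blast
  qed
  ultimately show ?thesis
    by (simp add: hilbert_post_complete_def equational_theory_op_equivalence
        not_inconsistent_op_equivalence)
qed

end
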